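(* Suppose that $d_u,d_v,U_0,V_0\in\mathbb{R}$ are all strictly positive, and let $a\in\mathbb{R}$ be the unique root of the equation $$d_uU_0\int_a^\infty e^{\frac{a^2-s^2}{4d_v}}\,ds=d_vV_0\int_{-\infty}^a e^{\frac{a^2-s^2}{4d_u}}\,ds.$$ Then (i) if $d_u=d_v$ and $U_0=V_0$, then $a=0$; (ii) if $d_u\le d_v$ and $\sqrt{d_u}\,U_0\le\sqrt{d_v}\,V_0$, then $a<0$; (iii) if $d_u\ge d_v$ and $\sqrt{d_u}\,U_0\ge\sqrt{d_v}\,V_0$, then $a>0$.
   Context: No further definitions are needed.
   Formalization: In (ii) and (iii) the strict sign of a is claimed only when √d_u U_0 ≠ √d_v V_0; when they are equal only a ≤ 0 (resp. a ≥ 0) is claimed, since then a = 0 (e.g. d_u = d_v = U_0 = V_0 = 1), so the printed strict sign is false. *)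

theory Defs
  imports "HOL-Analysis.Analysis"
begin

(* The set integrals are Lebesgue integrals; for d_u, d_v > 0 both integrands are
   integrable for every real a, so no junk value is involved.

   At a = 0 the equation reads sqrt d_u * U0 = sqrt d_v * V0, so in that borderline case the
   root is 0 whatever the relation between d_u and d_v is, and a
   strict sign of the root can only be claimed when sqrt d_u * U0 and sqrt d_v * V0 differ. *)
definition root_equation :: "real \<Rightarrow> real \<Rightarrow> real \<Rightarrow> real \<Rightarrow> real \<Rightarrow> bool" where
  "root_equation d_u d_v U0 V0 a \<longleftrightarrow>
     d_u * U0 * (LBINT s:{a..}. exp ((a\<^sup>2 - s\<^sup>2) / (4 * d_v)))
   = d_v * V0 * (LBINT s:{..a}. exp ((a\<^sup>2 - s\<^sup>2) / (4 * d_u)))"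

end

theory Submission
  imports Defs "HOL-Probability.Distributions"
begin

text \<open>
  Put \<open>M c a = \<integral>\<^sub>0\<^sup>\<infinity> exp (- (2 a t + t\<^sup>2) / (4 c)) dt\<close>. The substitutions \<open>s = a + t\<close> and \<open>s = a - t\<close>
  turn the equation into \<open>d_u U0 M d_v a = d_v V0 M d_u (- a)\<close>. As \<open>M c\<close> is positive and strictly
  decreasing, so is the difference of the two sides as a function of \<open>a\<close>, whence uniqueness; as
  \<open>M c\<close> is convex, it is continuous, and \<open>M c a \<le> 2 c / a\<close> makes the difference change sign,
  whence existence. At \<open>a = 0\<close> the difference has the sign of \<open>sqrt d_u * U0 - sqrt d_v * V0\<close>,
  which by monotonicity decides the sign of the root.
\<close>

text \<open>The integral of \<open>g - f\<close> over \<open>A\<close> is nonnegative. Were it zero,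
  \<open>g - f\<close> would vanish a.e. on \<open>A\<close>, so that \<open>A\<close> would be a
  null set.\<close>

lemma set_integral_less_AE:
  fixes f g :: "'a \<Rightarrow> real"
  assumes f: "set_integrable M A f" and g: "set_integrable M A g"
    and A: "A \<in> sets M" "emeasure M A \<noteq> 0"
    and less: "AE x\<in>A in M. f x < g x"
  shows "(LINT x:A|M. f x) < (LINT x:A|M. g x)"
proof -
  have int: "set_integrable M A (\<lambda>x. g x - f x)"
    by (rule set_integral_diff(1)[OF g f])
  have nonneg: "AE x in M. 0 \<le> indicator A x *\<^sub>R (g x - f x)"
    using less by eventually_elim (auto simp: indicator_def)
  have "(LINT x:A|M. g x - f x) \<noteq> 0"
  proof
    assume "(LINT x:A|M. g x - f x) = 0"
    then have "AE x in M. indicator A x *\<^sub>R (g x - f x) = 0"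
      using integral_nonneg_eq_0_iff_AE[OF int[unfolded set_integrable_def] nonneg]
      by (simp add: set_lebesgue_integral_def)
    with less have "AE x in M. x \<notin> A"
      by eventually_elim (auto simp: indicator_def)
    then show False
      using A AE_iff_measurable[OF A(1), of "\<lambda>x. x \<notin> A"] sets.sets_into_space[OF A(1)]
      by (auto simp: Collect_conj_eq Int_absorb1)
  qed
  moreover have "0 \<le> (LINT x:A|M. g x - f x)"
    unfolding set_lebesgue_integral_def by (rule integral_nonneg_AE[OF nonneg])
  ultimately show ?thesis
    using set_integral_diff(2)[OF g f] by simp
qed

text \<open>This is \<open>M\<close> above. For \<open>c > 0\<close> it equals \<open>sqrt (pi * c)
  * exp (a^2 / (4 * c)) * erfc (a / (2 * sqrt c))\<close>, a scaled complementary error function.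
  The domain is fixed and the exponent is affine in \<open>a\<close>, so monotonicity and convexity
  in \<open>a\<close> hold pointwise under the integral.\<close>

definition half_gauss :: "real \<Rightarrow> real \<Rightarrow> real" where
  "half_gauss c a = (LBINT t:{0..}. exp (- (2 * a * t + t\<^sup>2) / (4 * c)))"

lemma set_integrable_half_gauss:
  fixes a c :: real
  assumes "c > 0"
  shows "set_integrable lborel {0..} (\<lambda>t. exp (- (2 * a * t + t\<^sup>2) / (4 * c)))"
proof -
  \<comment> \<open>Completing the square gives the exponential factor; the root undoes the
    normalisation of a normal density with variance \<open>2 * c\<close>.\<close>
  define K where "K = exp (a\<^sup>2 / (4 * c)) * sqrt (4 * pi * c)"
  have eq: "exp (- (2 * a * t + t\<^sup>2) / (4 * c)) = K * normal_density (- a) (sqrt (2 * c)) t" for t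
  proof -
    have "K * normal_density (- a) (sqrt (2 * c)) t = exp (a\<^sup>2 / (4 * c)) * exp (- (t + a)\<^sup>2 / (4 * c))"
      using assms by (simp add: K_def normal_density_def real_sqrt_mult power_mult_distrib)
    also have "\<dots> = exp (- (2 * a * t + t\<^sup>2) / (4 * c))"
      using assms by (simp add: exp_add[symmetric] power2_eq_square field_simps)
    finally show ?thesis ..
  qed
  have "set_integrable lborel UNIV (\<lambda>t. K * normal_density (- a) (sqrt (2 * c)) t)"
    using assms by (simp add: set_integrable_def)
  then show ?thesis
    unfolding eq by (rule set_integrable_subset) auto
qed

lemma emeasure_lborel_Ici_nonzero: "emeasure lborel {a::real..} \<noteq> 0"
proof
  assume "emeasure lborel {a..} = 0"
  then have "emeasure lborel {a..a + 1} = 0"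
    by (rule emeasure_eq_0[rotated]) auto
  then show False
    by simp
qed

lemma half_gauss_pos:
  assumes "c > 0"
  shows "half_gauss c a > 0"
proof -
  have "(LBINT t:{0::real..}. 0) < half_gauss c a"
    unfolding half_gauss_def
    by (rule set_integral_less_AE[OF _ set_integrable_half_gauss[OF assms]])
      (auto simp: set_integrable_def emeasure_lborel_Ici_nonzero)
  then show ?thesis
    by simp
qed

lemma half_gauss_strict_antimono:
  assumes "c > 0" and "a < b"
  shows "half_gauss c b < half_gauss c a"
  unfolding half_gauss_def
proof (rule set_integral_less_AE[OF set_integrable_half_gauss set_integrable_half_gauss])
  show "AE t\<in>{0..} in lborel. exp (- (2 * b * t + t\<^sup>2) / (4 * c)) < exp (- (2 * a * t + t\<^sup>2) / (4 * c))"
    \<comment> \<open>Both integrands equal 1 at \<open>t = 0\<close>, so strictness holds only off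
      this point.\<close>
    using AE_lborel_singleton[of "0::real"]
    by eventually_elim (use assms in \<open>auto simp: divide_less_cancel\<close>)
qed (use assms emeasure_lborel_Ici_nonzero in auto)

text \<open>For fixed \<open>t\<close> the integrand is \<open>exp\<close> of an affine function of
  \<open>a\<close>, hence convex in \<open>a\<close>, and integration preserves the convexity
  inequality.\<close>

lemma convex_on_half_gauss:
  assumes "c > 0"
  shows "convex_on UNIV (half_gauss c)"
proof (rule convex_onI)
  fix r a b :: real
  assume r: "r > 0" "r < 1"
  define e where "e a t = - (2 * a * t + t\<^sup>2) / (4 * c)" for a t
  have int: "set_integrable lborel {0..} (\<lambda>t. exp (e a t))" for a
    unfolding e_def by (rule set_integrable_half_gauss[OF assms])
  note int' = set_integrable_mult_right[OF int, of "1 - r" a] set_integrable_mult_right[OF int, of r b]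
  have eq: "half_gauss c a = (LBINT t:{0..}. exp (e a t))" for a
    by (simp add: half_gauss_def e_def)
  have "exp (e ((1 - r) *\<^sub>R a + r *\<^sub>R b) t) \<le> (1 - r) * exp (e a t) + r * exp (e b t)" for t
  proof -
    have "e ((1 - r) *\<^sub>R a + r *\<^sub>R b) t = (1 - r) *\<^sub>R e a t + r *\<^sub>R e b t"
      using assms by (simp add: e_def field_simps)
    then show ?thesis
      using convex_onD[OF exp_convex, of r "e a t" "e b t"] r by simp
  qed
  then have "half_gauss c ((1 - r) *\<^sub>R a + r *\<^sub>R b)
      \<le> (LBINT t:{0..}. (1 - r) * exp (e a t) + r * exp (e b t))"
    unfolding eq by (rule set_integral_mono[OF int set_integral_add(1)[OF int']])
  also have "\<dots> = (1 - r) * half_gauss c a + r * half_gauss c b"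
    unfolding eq set_integral_add(2)[OF int'] by simp
  finally show "half_gauss c ((1 - r) *\<^sub>R a + r *\<^sub>R b) \<le> (1 - r) * half_gauss c a + r * half_gauss c b" .
qed simp

lemma continuous_on_half_gauss:
  assumes "c > 0"
  shows "continuous_on UNIV (half_gauss c)"
  by (rule convex_on_continuous[OF open_UNIV convex_on_half_gauss[OF assms]])

text \<open>Dropping the \<open>t^2\<close> term bounds the integrand by
  \<open>exp (- k * t)\<close> with \<open>k = a / (2 * c)\<close>, whose integral is
  \<open>1 / k\<close>.\<close>

lemma half_gauss_le:
  assumes "c > 0" and "a > 0"
  shows "half_gauss c a \<le> 2 * c / a"
proof -
  define k where "k = a / (2 * c)"
  have "k > 0"
    using assms by (simp add: k_def)
  have hi: "((\<lambda>t. exp (- k * t)) has_integral 1 / k) {0..}"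
    using has_integral_exp_minus_to_infinity[OF \<open>k > 0\<close>, of 0] by simp
  note int = set_borel_integral_eq_integral[OF set_integrable_half_gauss[OF assms(1), of a]]
  have "half_gauss c a = integral {0..} (\<lambda>t. exp (- (2 * a * t + t\<^sup>2) / (4 * c)))"
    unfolding half_gauss_def by (rule int(2))
  also have "\<dots> \<le> 1 / k"
  proof (rule has_integral_le[OF integrable_integral[OF int(1)] hi])
    fix t :: real
    have "- (2 * a * t + t\<^sup>2) / (4 * c) = - k * t - t\<^sup>2 / (4 * c)"
      using assms by (simp add: k_def field_simps)
    then show "exp (- (2 * a * t + t\<^sup>2) / (4 * c)) \<le> exp (- k * t)"
      using assms by simp
  qed
  finally show ?thesis
    by (simp add: k_def)
qed

lemma half_gauss_0:
  assumes "c > 0"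
  shows "half_gauss c 0 = sqrt (pi * c)"
proof -
  \<comment> \<open>Rescaling by \<open>2 * sqrt c\<close> reduces the integral to the half-line
    Gaussian integral \<open>sqrt pi / 2\<close>.\<close>
  have "half_gauss c 0
      = \<bar>2 * sqrt c\<bar> *\<^sub>R (\<integral>t. indicator {0..} (0 + 2 * sqrt c * t)
          *\<^sub>R exp (- (2 * 0 * (0 + 2 * sqrt c * t) + (0 + 2 * sqrt c * t)\<^sup>2) / (4 * c)) \<partial>lborel)"
    unfolding half_gauss_def set_lebesgue_integral_def
    by (rule lborel_integral_real_affine) (use assms in auto)
  also have "(\<lambda>t. indicator {0..} (0 + 2 * sqrt c * t)
        *\<^sub>R exp (- (2 * 0 * (0 + 2 * sqrt c * t) + (0 + 2 * sqrt c * t)\<^sup>2) / (4 * c)))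
      = (\<lambda>t. indicator {0..} t *\<^sub>R exp (- t\<^sup>2))"
    using assms by (auto simp: fun_eq_iff indicator_def power_mult_distrib zero_le_mult_iff)
  also have "\<bar>2 * sqrt c\<bar> *\<^sub>R (\<integral>t. indicator {0..} t *\<^sub>R exp (- t\<^sup>2) \<partial>lborel) = sqrt (pi * c)"
    using assms has_bochner_integral_integral_eq[OF gaussian_moment_0]
    by (simp add: real_sqrt_mult)
  finally show ?thesis .
qed

lemma half_gauss_eq_upper:
  "(LBINT s:{a..}. exp ((a\<^sup>2 - s\<^sup>2) / (4 * c))) = half_gauss c a"
proof -
  have "(LBINT s:{a..}. exp ((a\<^sup>2 - s\<^sup>2) / (4 * c)))
      = \<bar>1\<bar> *\<^sub>R (\<integral>t. indicator {a..} (a + 1 * t) *\<^sub>R exp ((a\<^sup>2 - (a + 1 * t)\<^sup>2) / (4 * c)) \<partial>lborel)"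
    unfolding set_lebesgue_integral_def by (rule lborel_integral_real_affine) simp
  also have "\<dots> = half_gauss c a"
    unfolding half_gauss_def set_lebesgue_integral_def
    by (auto simp: indicator_def power2_eq_square algebra_simps intro!: Bochner_Integration.integral_cong)
  finally show ?thesis .
qed

text \<open>The reflection \<open>s = a - t\<close> gives
  \<open>a^2 - s^2 = 2 * a * t - t^2\<close>, hence the argument \<open>- a\<close>.\<close>

lemma half_gauss_eq_lower:
  "(LBINT s:{..a}. exp ((a\<^sup>2 - s\<^sup>2) / (4 * c))) = half_gauss c (- a)"
proof -
  have "(LBINT s:{..a}. exp ((a\<^sup>2 - s\<^sup>2) / (4 * c)))
      = \<bar>- 1\<bar> *\<^sub>R (\<integral>t. indicator {..a} (a + (- 1) * t) *\<^sub>R exp ((a\<^sup>2 - (a + (- 1) * t)\<^sup>2) / (4 * c)) \<partial>lborel)"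
    unfolding set_lebesgue_integral_def by (rule lborel_integral_real_affine) simp
  also have "\<dots> = half_gauss c (- a)"
    unfolding half_gauss_def set_lebesgue_integral_def
    by (auto simp: indicator_def power2_eq_square algebra_simps intro!: Bochner_Integration.integral_cong)
  finally show ?thesis .
qed

text \<open>This supplies both endpoints for the intermediate value theorem, the left one after
  exchanging the two species.\<close>

lemma half_gauss_balance_neg:
  assumes "c > 0" "d > 0" "p > 0" "q > 0"
  shows "\<exists>a>0. p * half_gauss c a - q * half_gauss d (- a) < 0"
proof -
  define h where "h = q * half_gauss d 0"
  have h: "h > 0"
    using half_gauss_pos[OF assms(2)] assms by (simp add: h_def)
  \<comment> \<open>Chosen so that the upper bound \<open>p * (2 * c / a)\<close> is exactly
    \<open>h / 2\<close>.\<close>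
  define a where "a = 4 * p * c / h"
  have a: "a > 0"
    using assms h by (simp add: a_def)
  have "p * half_gauss c a \<le> p * (2 * c / a)"
    using half_gauss_le[OF assms(1) a] assms by (intro mult_left_mono) auto
  also have "\<dots> = h / 2"
    using assms h by (simp add: a_def)
  also have "\<dots> < h"
    using h by simp
  also have "h < q * half_gauss d (- a)"
    using half_gauss_strict_antimono[OF assms(2), of "- a" 0] a assms by (simp add: h_def)
  finally show ?thesis
    using a by auto
qed

theorem proposition2p27:
  fixes d_u d_v U0 V0 :: real
  assumes "d_u > 0" and "d_v > 0" and "U0 > 0" and "V0 > 0"
  shows "(\<exists>!a. root_equation d_u d_v U0 V0 a) \<and>
    (\<forall>a. root_equation d_u d_v U0 V0 a \<longrightarrow>
      (d_u = d_v \<and> U0 = V0 \<longrightarrow> a = 0) \<and>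
      (d_u \<le> d_v \<and> sqrt d_u * U0 \<le> sqrt d_v * V0 \<longrightarrow>
         a \<le> 0 \<and> (sqrt d_u * U0 < sqrt d_v * V0 \<longrightarrow> a < 0)) \<and>
      (d_u \<ge> d_v \<and> sqrt d_u * U0 \<ge> sqrt d_v * V0 \<longrightarrow>
         a \<ge> 0 \<and> (sqrt d_u * U0 > sqrt d_v * V0 \<longrightarrow> a > 0)))"
proof -
  define F where "F a = d_u * U0 * half_gauss d_v a - d_v * V0 * half_gauss d_u (- a)" for a
  have root: "root_equation d_u d_v U0 V0 a \<longleftrightarrow> F a = 0" for a
    by (simp add: root_equation_def F_def half_gauss_eq_upper half_gauss_eq_lower)
  have pos: "d_u * U0 > 0" "d_v * V0 > 0"
    using assms by simp_all
  have dec: "F b < F a" if "a < b" for a b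
    unfolding F_def using that pos assms
    by (intro diff_strict_mono mult_strict_left_mono half_gauss_strict_antimono) auto
  have cont: "continuous_on S F" for S
    unfolding F_def
    by (intro continuous_intros continuous_on_compose2[OF continuous_on_half_gauss]) (use assms in auto)
  obtain b where b: "b > 0" "F b < 0"
    using half_gauss_balance_neg[OF assms(2,1) pos] by (auto simp: F_def)
  \<comment> \<open>Exchanging \<open>(d_u, U0)\<close> with \<open>(d_v, V0)\<close> turns
    \<open>F a\<close> into \<open>- F (- a)\<close>.\<close>
  obtain a where a: "a > 0" "F (- a) > 0"
    using half_gauss_balance_neg[OF assms(1,2) pos(2,1)] by (auto simp: F_def)
  obtain x where x: "F x = 0"
    using IVT2'[of F b 0 "- a"] a b cont by auto
  have uniq: "y = x" if "F y = 0" for y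
    using dec[of x y] dec[of y x] that x by (cases x y rule: linorder_cases) auto
  have sq: "d_u = sqrt d_u * sqrt d_u" "d_v = sqrt d_v * sqrt d_v"
    using assms by simp_all
  have "F 0 = d_u * U0 * (sqrt pi * sqrt d_v) - d_v * V0 * (sqrt pi * sqrt d_u)"
    using assms by (simp add: F_def half_gauss_0 real_sqrt_mult)
  \<comment> \<open>Only the coefficients \<open>d_u\<close> and \<open>d_v\<close> are split into
    square roots, not their occurrences under \<open>sqrt\<close>.\<close>
  also have "\<dots> = sqrt pi * sqrt d_u * sqrt d_v * (sqrt d_u * U0 - sqrt d_v * V0)"
    by (subst (1) sq(1), subst (2) sq(2)) (simp add: algebra_simps)
  finally have F0: "F 0 = sqrt pi * sqrt d_u * sqrt d_v * (sqrt d_u * U0 - sqrt d_v * V0)" .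
  \<comment> \<open>As \<open>F\<close> strictly decreases through zero at \<open>y\<close>, the
    signs of \<open>y\<close> and \<open>F 0\<close> agree. Having both equivalences also covers
    equality, which forces \<open>y = 0\<close>, and gives the weak inequalities by
    negation.\<close>
  have sign: "y < 0 \<longleftrightarrow> sqrt d_u * U0 < sqrt d_v * V0" "y > 0 \<longleftrightarrow> sqrt d_u * U0 > sqrt d_v * V0"
    if "F y = 0" for y
  proof -
    have "y < 0 \<longleftrightarrow> F 0 < 0" "y > 0 \<longleftrightarrow> F 0 > 0"
      using dec[of y 0] dec[of 0 y] that less_linear[of y 0] by force+
    then show "y < 0 \<longleftrightarrow> sqrt d_u * U0 < sqrt d_v * V0" "y > 0 \<longleftrightarrow> sqrt d_u * U0 > sqrt d_v * V0"
      using assms by (simp_all add: F0 mult_less_0_iff zero_less_mult_iff)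
  qed
  show ?thesis
    unfolding root
  proof (intro conjI allI impI)
    show "\<exists>!a. F a = 0"
      using x uniq by blast
    fix y
    assume y: "F y = 0"
    show "y = 0" if "d_u = d_v \<and> U0 = V0"
      using sign[OF y] that by simp
  qed (use sign in \<open>simp_all add: not_less[symmetric]\<close>)
qed

end
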